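(* Let $A$ and $B$ be transition matrices on the finite state space $\mathcal{X}$ such that $B$ is $\gamma$-controlled by $A$ for some $\gamma\in(0,1)$, i.e. $B\ge\gamma A$ componentwise. If the (time-homogeneous) Markov chain $X$ is uniformly ergodic under the measure induced by $A$, then $X$ is also uniformly ergodic under the measure induced by $B$: there exist a probability measure $\pi$ on $\mathcal{X}$ and constants $R,\rho>0$ such that $$\sup_{\mu}\|P_t\mu-\pi\|_{TV}\le Re^{-\rho t}\quad\text{for all } t\ge0,$$ where $P_t\mu$ is the law of $X_t$ under transition matrix $B$ given $X_0\sim\mu$ and the supremum is over all probability measures $\mu$ on $\mathcal{X}$. Furthermore, the constants $R$ and $\rho$ can be chosen depending only on $A$ and $\gamma$ (that is, the same $R,\rho$ work for every transition matrix $B$ with $B\ge\gamma A$), and $R$ can be made arbitrarily close to $1$ (with a corresponding decrease in $\rho$).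
   Context: $\mathcal{X}=\{e_1,\dots,e_N\}$ is the standard basis of $\mathbb{R}^N$. Transition matrices are $N\times N$ column-stochastic matrices: the $(i,j)$ entry is the probability of a jump from $e_j$ to $e_i$. Time is discrete, $t\in\{0,1,2,\dots\}$. "Under the measure induced by $A$" means that $X$ is a time-homogeneous Markov chain with transition matrix $A$. For a finite signed measure $\mu$ on $\mathcal{X}$, $\|\mu\|_{TV}:=\frac12\sum_{x\in\mathcal{X}}|\mu(\{x\})|$. A time-homogeneous chain with transition operators $P_t$ ($P_t\mu$ = law of $X_t$ given $X_0\sim\mu$) is uniformly ergodic if there are a probability measure $\pi$ on $\mathcal{X}$ and $R,\rho>0$ with $\sup_\mu\|P_t\mu-\pi\|_{TV}\le Re^{-\rho t}$ for all $t\ge0$, the supremum being over probability measures $\mu$ on $\mathcal{X}$. *)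

theory Defs
  imports "HOL-Probability.Probability"
begin

text \<open>
  The state space is the standard basis of \<open>real^'n\<close>, i.e. the vectors \<open>axis i 1\<close>.  A finite
  signed measure \<open>\<mu>\<close> on it is represented by the vector of its point masses,
  \<open>\<mu> $ i = \<mu>({axis i 1})\<close>.
\<close>

definition prob_measures :: "(real^'n) set" where
  "prob_measures = {\<mu>. (\<forall>i. 0 \<le> \<mu> $ i) \<and> (\<Sum>i\<in>UNIV. \<mu> $ i) = 1}"

definition tv_norm :: "real^'n \<Rightarrow> real" where
  "tv_norm \<mu> = 1/2 * (\<Sum>i\<in>UNIV. \<bar>\<mu> $ i\<bar>)"

text \<open>Column convention: \<open>A $ i $ j\<close> is the probability of a jump from \<open>axis j 1\<close> to \<open>axis i 1\<close>.\<close>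

definition transition_matrix :: "real^'n^'n \<Rightarrow> bool" where
  "transition_matrix A \<longleftrightarrow> (\<forall>i j. 0 \<le> A $ i $ j) \<and> (\<forall>j. (\<Sum>i\<in>UNIV. A $ i $ j) = 1)"

definition controlled_by :: "real \<Rightarrow> real^'n^'n \<Rightarrow> real^'n^'n \<Rightarrow> bool" where
  "controlled_by \<gamma> A B \<longleftrightarrow> (\<forall>i j. B $ i $ j \<ge> \<gamma> * A $ i $ j)"

text \<open>
  \<open>transition_op A t \<mu>\<close> is \<open>A\<^sup>t \<mu>\<close>; lemma \<open>markov_chain_law\<close> below shows that it is the law of
  \<open>X\<^sub>t\<close> for every time-homogeneous Markov chain \<open>X\<close> with transition matrix \<open>A\<close> and
  initial law \<open>\<mu>\<close>.
\<close>

definition transition_op :: "real^'n^'n \<Rightarrow> nat \<Rightarrow> real^'n \<Rightarrow> real^'n" where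
  "transition_op A t \<mu> = (((*v) A) ^^ t) \<mu>"

text \<open>
  The supremum is a real one.  It is meaningful whenever each \<open>P t\<close> maps probability measures to
  probability measures, since then it ranges over a nonempty set of numbers in \<open>{0..1}\<close>.
\<close>

definition ergodic_with ::
  "(nat \<Rightarrow> real^'n \<Rightarrow> real^'n) \<Rightarrow> real^'n \<Rightarrow> real \<Rightarrow> real \<Rightarrow> bool" where
  "ergodic_with P \<pi> R \<rho> \<longleftrightarrow>
     (\<forall>t. (SUP \<mu>\<in>prob_measures. tv_norm (P t \<mu> - \<pi>)) \<le> R * exp (- \<rho> * real t))"

definition uniformly_ergodic :: "(nat \<Rightarrow> real^'n \<Rightarrow> real^'n) \<Rightarrow> bool" where
  "uniformly_ergodic P \<longleftrightarrow> (\<exists>\<pi>\<in>prob_measures. \<exists>R>0. \<exists>\<rho>>0. ergodic_with P \<pi> R \<rho>)"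

text \<open>
  The Markov property is stated multiplicatively, so that no case distinction is needed for
  conditioning on histories of probability zero.
\<close>

definition markov_chain :: "'a measure \<Rightarrow> (nat \<Rightarrow> 'a \<Rightarrow> real^'n) \<Rightarrow> real^'n^'n \<Rightarrow> bool" where
  "markov_chain M X A \<longleftrightarrow> prob_space M \<and>
     (\<forall>t. X t \<in> borel_measurable M) \<and> (\<forall>t. \<forall>\<omega>\<in>space M. X t \<omega> \<in> Basis) \<and>
     (\<forall>t i (x :: nat \<Rightarrow> 'n).
        measure M {\<omega>\<in>space M. X (Suc t) \<omega> = axis i 1 \<and> (\<forall>s\<le>t. X s \<omega> = axis (x s) 1)} =
        A $ i $ x t * measure M {\<omega>\<in>space M. \<forall>s\<le>t. X s \<omega> = axis (x s) 1})"

definition law :: "'a measure \<Rightarrow> ('a \<Rightarrow> real^'n) \<Rightarrow> real^'n" where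
  "law M Y = (\<chi> i. measure M {\<omega>\<in>space M. Y \<omega> = axis i 1})"

lemma markov_chain_law_Suc:
  fixes A :: "real^'n^'n"
  assumes "markov_chain M X A"
  shows "law M (X (Suc t)) = A *v law M (X t)"
proof -
  interpret prob_space M using assms by (simp add: markov_chain_def)
  have [measurable]: "X s \<in> borel_measurable M" for s
    using assms by (simp add: markov_chain_def)
  have basis: "\<exists>i. X s \<omega> = axis i 1" if "\<omega> \<in> space M" for s \<omega>
    using assms that by (fastforce simp: markov_chain_def Basis_vec_def)
  define paths where "paths = PiE {..t} (\<lambda>_. UNIV :: 'n set)"
  define F where "F x = {\<omega>\<in>space M. \<forall>s\<le>t. X s \<omega> = axis (x s) 1}" for x :: "nat \<Rightarrow> 'n"
  have F[measurable]: "F x \<in> sets M" for x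
    unfolding F_def by measurable
  have fin: "finite paths" unfolding paths_def by (intro finite_PiE) auto
  have inj: "i = j" if "axis i (1::real) = axis j 1" for i j :: 'n
    using that by (simp add: axis_eq_axis)
  have split: "prob E = (\<Sum>x\<in>paths. prob (E \<inter> F x))" if E[measurable]: "E \<in> sets M" for E
  proof -
    have eq: "E = (\<Union>x\<in>paths. E \<inter> F x)"
    proof (intro equalityI subsetI)
      fix \<omega> assume w: "\<omega> \<in> E"
      then have sp: "\<omega> \<in> space M" using sets.sets_into_space[OF E] by auto
      obtain y where y: "\<And>s. X s \<omega> = axis (y s) 1" using basis[OF sp] by metis
      have "restrict y {..t} \<in> paths" by (simp add: paths_def)
      moreover have "\<omega> \<in> F (restrict y {..t})" using sp y by (simp add: F_def)
      ultimately show "\<omega> \<in> (\<Union>x\<in>paths. E \<inter> F x)" using w by blast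
    qed auto
    have "(\<lambda>x. E \<inter> F x) ` paths \<subseteq> sets M" by auto
    moreover have "disjoint_family_on (\<lambda>x. E \<inter> F x) paths"
    proof (unfold disjoint_family_on_def, intro ballI impI, rule ccontr)
      fix x y assume xy: "x \<in> paths" "y \<in> paths" "x \<noteq> y" and "E \<inter> F x \<inter> (E \<inter> F y) \<noteq> {}"
      then obtain \<omega> where "\<omega> \<in> F x" "\<omega> \<in> F y" by auto
      then have "x s = y s" if "s \<le> t" for s
        using that inj[of "x s" "y s"] by (auto simp: F_def)
      then have "x = y" using xy(1,2) unfolding paths_def by (intro PiE_ext) auto
      then show False using xy(3) by simp
    qed
    ultimately have "prob (\<Union>x\<in>paths. E \<inter> F x) = (\<Sum>x\<in>paths. prob (E \<inter> F x))"
      using finite_measure_finite_Union[OF fin, of "\<lambda>x. E \<inter> F x"] by blast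
    then show ?thesis using eq by simp
  qed
  have cur: "law M (X t) $ j = (\<Sum>x\<in>paths. if x t = j then prob (F x) else 0)" for j
  proof -
    have "prob ({\<omega>\<in>space M. X t \<omega> = axis j 1} \<inter> F x) = (if x t = j then prob (F x) else 0)" for x
    proof (cases "x t = j")
      case True
      then have "{\<omega>\<in>space M. X t \<omega> = axis j 1} \<inter> F x = F x" by (auto simp: F_def)
      then show ?thesis using True by simp
    next
      case False
      then have "{\<omega>\<in>space M. X t \<omega> = axis j 1} \<inter> F x = {}" using inj by (fastforce simp: F_def)
      then show ?thesis using False by simp
    qed
    moreover have "prob {\<omega>\<in>space M. X t \<omega> = axis j 1} =
        (\<Sum>x\<in>paths. prob ({\<omega>\<in>space M. X t \<omega> = axis j 1} \<inter> F x))"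
      by (rule split) measurable
    ultimately show ?thesis by (simp add: law_def)
  qed
  show ?thesis
  proof (subst vec_eq_iff, rule allI)
    fix i
    have "prob ({\<omega>\<in>space M. X (Suc t) \<omega> = axis i 1} \<inter> F x) = A $ i $ x t * prob (F x)" for x
    proof -
      have "{\<omega>\<in>space M. X (Suc t) \<omega> = axis i 1} \<inter> F x =
        {\<omega>\<in>space M. X (Suc t) \<omega> = axis i 1 \<and> (\<forall>s\<le>t. X s \<omega> = axis (x s) 1)}"
        by (auto simp: F_def)
      then show ?thesis using assms by (simp add: markov_chain_def F_def)
    qed
    moreover have "prob {\<omega>\<in>space M. X (Suc t) \<omega> = axis i 1} =
        (\<Sum>x\<in>paths. prob ({\<omega>\<in>space M. X (Suc t) \<omega> = axis i 1} \<inter> F x))"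
      by (rule split) measurable
    ultimately have "law M (X (Suc t)) $ i = (\<Sum>x\<in>paths. A $ i $ x t * prob (F x))"
      by (simp add: law_def)
    also have "\<dots> = (\<Sum>x\<in>paths. \<Sum>j\<in>UNIV. A $ i $ j * (if x t = j then prob (F x) else 0))"
      by (simp add: if_distrib cong: if_cong)
    also have "\<dots> = (\<Sum>j\<in>UNIV. A $ i $ j * law M (X t) $ j)"
      by (subst sum.swap) (simp add: cur sum_distrib_left)
    finally show "law M (X (Suc t)) $ i = (A *v law M (X t)) $ i"
      by (simp add: matrix_vector_mult_def)
  qed
qed

lemma markov_chain_law:
  assumes "markov_chain M X A"
  shows "law M (X t) = transition_op A t (law M (X 0))"
  by (induction t) (simp_all add: transition_op_def markov_chain_law_Suc[OF assms])

end

theory Submission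
  imports Defs "HOL-Real_Asymp.Real_Asymp"
begin

text \<open>
  Since \<open>A\<^sup>t\<mu>\<close> converges uniformly to \<open>\<pi>\<close>, some power \<open>A\<^sup>T\<close> puts mass at least \<open>\<pi>\<^sub>k / 2\<close> on a fixed
  state \<open>k\<close>, whatever the initial law.  As \<open>B\<^sup>T \<ge> \<gamma>\<^sup>T A\<^sup>T\<close>, Doeblin's condition holds for \<open>B\<^sup>T\<close> with
  \<open>\<epsilon> = \<gamma>\<^sup>T \<pi>\<^sub>k / 2\<close>, which depends on \<open>A\<close> and \<open>\<gamma>\<close> only, so \<open>B\<^sup>T\<close> contracts the total variation
  distance by \<open>1 - \<epsilon>\<close>.  Comparing with a stationary law of \<open>B\<close> (which exists by Brouwer's theorem)
  gives geometric convergence.  As distances never exceed \<open>1\<close>, a bound \<open>y = R e\<^sup>-\<^sup>\<rho>\<^sup>t\<close> may be replaced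
  by \<open>y\<^sup>\<theta>\<close> for any \<open>\<theta> \<in> (0, 1]\<close>, and \<open>R\<^sup>\<theta>\<close> is as close to \<open>1\<close> as desired.
\<close>

section \<open>Total variation distance of probability vectors\<close>

lemma prob_measures_nonempty: "prob_measures \<noteq> ({} :: (real^'n) set)"
proof -
  have "axis undefined 1 \<in> (prob_measures :: (real^'n) set)"
    by (simp add: prob_measures_def axis_def)
  then show ?thesis by auto
qed

lemma prob_measures_le_1:
  assumes "\<mu> \<in> prob_measures"
  shows "\<mu> $ i \<le> 1"
  using assms member_le_sum[of i UNIV "\<lambda>i. \<mu> $ i"] by (auto simp: prob_measures_def)

lemma prob_measures_pos_mass:
  assumes "\<mu> \<in> prob_measures"
  obtains k where "0 < \<mu> $ k"
proof -
  have "\<not> (\<forall>i. \<mu> $ i = 0)"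
  proof
    assume "\<forall>i. \<mu> $ i = 0"
    then show False using assms by (simp add: prob_measures_def)
  qed
  then show ?thesis using assms that by (force simp: prob_measures_def less_le)
qed

lemma tv_norm_nonneg: "0 \<le> tv_norm v"
  by (simp add: tv_norm_def sum_nonneg)

lemma tv_norm_scaleR: "tv_norm (c *\<^sub>R v) = \<bar>c\<bar> * tv_norm v"
  by (simp add: tv_norm_def abs_mult sum_distrib_left algebra_simps)

lemma abs_component_le_tv_norm: "\<bar>v $ i\<bar> \<le> 2 * tv_norm v"
  using member_le_sum[of i UNIV "\<lambda>i. \<bar>v $ i\<bar>"] by (simp add: tv_norm_def)

text \<open>Since \<open>\<bar>a - b\<bar> = a + b - 2 * min a b\<close>, the distance of two
  probability vectors is one minus their total overlap, and the coordinate \<open>k\<close> alone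
  contributes at least \<open>\<epsilon>\<close> to that overlap.\<close>

lemma tv_norm_diff_le_overlap:
  assumes \<mu>: "\<mu> \<in> prob_measures" and \<nu>: "\<nu> \<in> prob_measures"
    and "\<epsilon> \<le> \<mu> $ k" "\<epsilon> \<le> \<nu> $ k"
  shows "tv_norm (\<mu> - \<nu>) \<le> 1 - \<epsilon>"
proof -
  have "\<epsilon> \<le> min (\<mu> $ k) (\<nu> $ k)" using assms by simp
  also have "\<dots> \<le> (\<Sum>i\<in>UNIV. min (\<mu> $ i) (\<nu> $ i))"
    using \<mu> \<nu> by (intro member_le_sum) (auto simp: prob_measures_def)
  finally have "\<epsilon> \<le> (\<Sum>i\<in>UNIV. min (\<mu> $ i) (\<nu> $ i))" .
  moreover have "tv_norm (\<mu> - \<nu>) = 1/2 * (\<Sum>i\<in>UNIV. \<mu> $ i + \<nu> $ i - 2 * min (\<mu> $ i) (\<nu> $ i))"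
    unfolding tv_norm_def by (intro arg_cong2[of _ _ _ _ "(*)"] sum.cong) (auto simp: min_def)
  ultimately show ?thesis
    using \<mu> \<nu> by (simp add: prob_measures_def sum_subtractf sum.distrib flip: sum_distrib_left)
qed

lemma tv_norm_diff_le_1:
  assumes "\<mu> \<in> prob_measures" "\<nu> \<in> prob_measures"
  shows "tv_norm (\<mu> - \<nu>) \<le> 1"
  using tv_norm_diff_le_overlap[OF assms, of 0] assms by (simp add: prob_measures_def)

text \<open>The coordinates of the difference sum to zero, so its positive and negative parts have
  the same mass, namely its \<open>tv_norm\<close>. Normalising both parts turns the distance into a
  scalar factor that a linear map lets through.\<close>

lemma jordan_decomposition:
  assumes "\<mu> \<in> prob_measures" "\<nu> \<in> prob_measures"
  obtains \<mu>' \<nu>' where "\<mu>' \<in> prob_measures" "\<nu>' \<in> prob_measures"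
    and "\<mu> - \<nu> = tv_norm (\<mu> - \<nu>) *\<^sub>R (\<mu>' - \<nu>')"
proof (cases "tv_norm (\<mu> - \<nu>) = 0")
  case True
  then have "\<mu> - \<nu> = 0" using abs_component_le_tv_norm[of "\<mu> - \<nu>"] by (simp add: vec_eq_iff)
  then show ?thesis using assms that True by simp
next
  case False
  define c where "c = tv_norm (\<mu> - \<nu>)"
  have c: "0 < c" using False tv_norm_nonneg[of "\<mu> - \<nu>"] by (simp add: c_def)
  define v where "v = \<mu> - \<nu>"
  have v0: "(\<Sum>i\<in>UNIV. v $ i) = 0"
    using assms by (simp add: v_def prob_measures_def sum_subtractf)
  have v1: "(\<Sum>i\<in>UNIV. \<bar>v $ i\<bar>) = 2 * c" by (simp add: c_def tv_norm_def v_def)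
  \<comment> \<open>\<open>p 1\<close> and \<open>p (-1)\<close> are the normalised positive and
    negative parts, because \<open>(\<bar>x\<bar> + x) / 2\<close> is the positive part of
    \<open>x\<close>.\<close>
  define p where "p s = (\<chi> i. (\<bar>v $ i\<bar> + s * v $ i) / (2 * c))" for s
  have p: "p s \<in> prob_measures" if "\<bar>s\<bar> = 1" for s
  proof -
    have "0 \<le> \<bar>v $ i\<bar> + s * v $ i" for i
      using that abs_ge_minus_self[of "s * v $ i"] by (simp add: abs_mult)
    then show ?thesis
      using c v0 v1
      by (simp add: prob_measures_def p_def sum.distrib flip: sum_divide_distrib sum_distrib_left)
  qed
  have "v = c *\<^sub>R (p 1 - p (-1))" using c by (simp add: vec_eq_iff p_def field_simps)
  then show ?thesis using that[of "p 1" "p (-1)"] p by (simp add: v_def c_def)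
qed

text \<open>By linearity it suffices to treat the normalised parts of \<open>\<mu> - \<nu>\<close>:
  their images under \<open>P\<close> overlap by at least \<open>\<epsilon>\<close> at
  \<open>k\<close>, hence lie within \<open>1 - \<epsilon>\<close> of each other.\<close>

lemma doeblin_contraction:
  assumes "linear P" and P: "\<And>\<mu>. \<mu> \<in> prob_measures \<Longrightarrow> P \<mu> \<in> prob_measures"
    and \<epsilon>: "\<And>\<mu>. \<mu> \<in> prob_measures \<Longrightarrow> \<epsilon> \<le> P \<mu> $ k"
    and \<mu>\<nu>: "\<mu> \<in> prob_measures" "\<nu> \<in> prob_measures"
  shows "tv_norm (P \<mu> - P \<nu>) \<le> (1 - \<epsilon>) * tv_norm (\<mu> - \<nu>)"
proof -
  obtain \<mu>' \<nu>' where *: "\<mu>' \<in> prob_measures" "\<nu>' \<in> prob_measures"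
    and eq: "\<mu> - \<nu> = tv_norm (\<mu> - \<nu>) *\<^sub>R (\<mu>' - \<nu>')"
    using jordan_decomposition[OF \<mu>\<nu>] .
  have "P \<mu> - P \<nu> = P (\<mu> - \<nu>)" using \<open>linear P\<close> by (simp add: linear_diff)
  also have "\<dots> = P (tv_norm (\<mu> - \<nu>) *\<^sub>R (\<mu>' - \<nu>'))" by (subst eq) rule
  also have "\<dots> = tv_norm (\<mu> - \<nu>) *\<^sub>R (P \<mu>' - P \<nu>')"
    using \<open>linear P\<close> by (simp add: linear_cmul linear_diff)
  finally have "tv_norm (P \<mu> - P \<nu>) = tv_norm (\<mu> - \<nu>) * tv_norm (P \<mu>' - P \<nu>')"
    by (simp add: tv_norm_scaleR tv_norm_nonneg)
  also have "\<dots> \<le> tv_norm (\<mu> - \<nu>) * (1 - \<epsilon>)"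
    using * by (intro mult_left_mono tv_norm_diff_le_overlap[where k = k] P \<epsilon> tv_norm_nonneg)
  finally show ?thesis by (simp add: mult.commute)
qed

section \<open>Transition operators\<close>

lemma transition_op_0 [simp]: "transition_op A 0 \<mu> = \<mu>"
  by (simp add: transition_op_def)

lemma transition_op_Suc: "transition_op A (Suc t) \<mu> = A *v transition_op A t \<mu>"
  by (simp add: transition_op_def)

lemma transition_op_add: "transition_op A (s + t) \<mu> = transition_op A s (transition_op A t \<mu>)"
  by (simp add: transition_op_def funpow_add)

lemma linear_transition_op: "linear (transition_op A t)"
proof (induction t)
  case 0
  then show ?case by (simp add: transition_op_def id_def[symmetric] linear_id)
next
  case (Suc t)
  then show ?case
    using linear_compose[OF Suc matrix_vector_mul_linear[of A]]
    by (simp add: transition_op_def o_def)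
qed

lemma transition_matrix_prob_measures:
  assumes "transition_matrix A" "\<mu> \<in> prob_measures"
  shows "A *v \<mu> \<in> prob_measures"
proof -
  have "(\<Sum>i\<in>UNIV. \<Sum>j\<in>UNIV. A $ i $ j * \<mu> $ j) = (\<Sum>j\<in>UNIV. (\<Sum>i\<in>UNIV. A $ i $ j) * \<mu> $ j)"
    by (subst sum.swap) (simp add: sum_distrib_right)
  then show ?thesis using assms
    by (auto simp: prob_measures_def transition_matrix_def matrix_vector_mult_def
        intro!: sum_nonneg)
qed

lemma transition_op_prob_measures:
  assumes "transition_matrix A" "\<mu> \<in> prob_measures"
  shows "transition_op A t \<mu> \<in> prob_measures"
  by (induction t) (simp_all add: assms transition_op_Suc transition_matrix_prob_measures)

lemma stationary_measure_exists:
  fixes A :: "real^'n^'n"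
  assumes "transition_matrix A"
  obtains \<pi> where "\<pi> \<in> prob_measures" "A *v \<pi> = \<pi>"
proof -
  let ?P = "prob_measures :: (real^'n) set"
  have "?P = (\<Inter>i. {\<mu>. 0 \<le> \<mu> $ i}) \<inter> {\<mu>. (\<Sum>i\<in>UNIV. \<mu> $ i) = 1}"
    by (auto simp: prob_measures_def)
  also have "closed \<dots>"
    by (intro closed_Int closed_INT ballI closed_Collect_le closed_Collect_eq continuous_intros)
  finally have "closed ?P" .
  moreover have "bounded ?P"
  proof (rule bounded_subset)
    show "?P \<subseteq> cbox 0 1"
      by (auto simp: mem_box_cart prob_measures_le_1) (simp add: prob_measures_def)
  qed (rule bounded_cbox)
  ultimately have "compact ?P" by (simp add: compact_eq_bounded_closed)
  moreover have "convex ?P"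
    by (auto simp: convex_def prob_measures_def sum.distrib simp flip: sum_distrib_left)
  moreover have "continuous_on ?P ((*v) A)"
    by (simp add: linear_continuous_on linear_linear matrix_vector_mul_linear)
  moreover have "(*v) A \<in> ?P \<rightarrow> ?P"
    using transition_matrix_prob_measures[OF assms] by auto
  ultimately show ?thesis
    using brouwer[of ?P "(*v) A"] prob_measures_nonempty that by blast
qed

lemma transition_op_stationary:
  assumes "A *v \<pi> = \<pi>"
  shows "transition_op A t \<pi> = \<pi>"
  by (induction t) (simp_all add: assms transition_op_Suc)

lemma transition_op_controlled:
  assumes "transition_matrix A" "controlled_by \<gamma> A B" "0 \<le> \<gamma>" and \<mu>: "\<mu> \<in> prob_measures"
  shows "\<gamma> ^ t * transition_op A t \<mu> $ i \<le> transition_op B t \<mu> $ i"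
proof (induction t arbitrary: i)
  case 0
  then show ?case by simp
next
  case (Suc t)
  have nn: "0 \<le> transition_op A t \<mu> $ j" for j
    using transition_op_prob_measures[OF assms(1) \<mu>] by (simp add: prob_measures_def)
  have *: "0 \<le> A $ i $ j" "\<gamma> * A $ i $ j \<le> B $ i $ j" for j
    using assms by (auto simp: transition_matrix_def controlled_by_def)
  have "\<gamma> ^ Suc t * transition_op A (Suc t) \<mu> $ i
      = (\<Sum>j\<in>UNIV. (\<gamma> * A $ i $ j) * (\<gamma> ^ t * transition_op A t \<mu> $ j))"
    by (simp add: transition_op_Suc matrix_vector_mult_def sum_distrib_left algebra_simps)
  also have "\<dots> \<le> (\<Sum>j\<in>UNIV. B $ i $ j * transition_op B t \<mu> $ j)"
  proof (intro sum_mono mult_mono)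
    fix j
    \<comment> \<open>The entries of \<open>B\<close> are nonnegative because they dominate those of
      \<open>\<gamma> * A\<close>.\<close>
    have "0 \<le> \<gamma> * A $ i $ j" using * \<open>0 \<le> \<gamma>\<close> by simp
    then show "0 \<le> B $ i $ j" using *(2)[of j] by linarith
  qed (use * Suc.IH nn \<open>0 \<le> \<gamma>\<close> in auto)
  finally show ?case by (simp add: transition_op_Suc matrix_vector_mult_def)
qed

section \<open>Ergodicity\<close>

text \<open>A real supremum bounds its members only if the set is bounded above; here
  \<open>1\<close> is a bound, as all laws involved are probability measures.\<close>

lemma ergodic_withD:
  assumes "ergodic_with (transition_op A) \<pi> R \<rho>" "transition_matrix A"
    and "\<pi> \<in> prob_measures" "\<mu> \<in> prob_measures"
  shows "tv_norm (transition_op A t \<mu> - \<pi>) \<le> R * exp (- \<rho> * real t)"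
proof -
  have "bdd_above ((\<lambda>\<mu>. tv_norm (transition_op A t \<mu> - \<pi>)) ` prob_measures)"
    using assms by (intro bdd_aboveI2[of _ _ 1] tv_norm_diff_le_1 transition_op_prob_measures)
  then have "tv_norm (transition_op A t \<mu> - \<pi>)
      \<le> (SUP \<mu>\<in>prob_measures. tv_norm (transition_op A t \<mu> - \<pi>))"
    by (intro cSUP_upper assms)
  then show ?thesis using assms(1) unfolding ergodic_with_def by (meson order_trans)
qed

lemma ergodic_withI:
  assumes "\<And>t \<mu>. \<mu> \<in> prob_measures \<Longrightarrow> tv_norm (P t \<mu> - \<pi>) \<le> R * exp (- \<rho> * real t)"
  shows "ergodic_with P \<pi> R \<rho>"
  unfolding ergodic_with_def
  using assms by (intro allI cSUP_least prob_measures_nonempty)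

lemma uniformly_ergodic_imp_minorization:
  fixes A :: "real^'n^'n"
  assumes "transition_matrix A" "uniformly_ergodic (transition_op A)"
  obtains T :: nat and k :: 'n and \<epsilon> :: real where "0 < T" "0 < \<epsilon>" "\<epsilon> < 1"
    and "\<And>\<mu>. \<mu> \<in> prob_measures \<Longrightarrow> \<epsilon> \<le> transition_op A T \<mu> $ k"
proof -
  obtain \<pi> R \<rho> where \<pi>: "\<pi> \<in> prob_measures" and "0 < R" "0 < \<rho>"
    and erg: "ergodic_with (transition_op A) \<pi> R \<rho>"
    using assms(2) by (auto simp: uniformly_ergodic_def)
  obtain k where k: "0 < \<pi> $ k" using prob_measures_pos_mass[OF \<pi>] .
  have "(\<lambda>t. R * exp (- \<rho> * real t)) \<longlonglongrightarrow> 0"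
    using \<open>0 < \<rho>\<close> by real_asymp
  \<comment> \<open>A quarter suffices because a coordinate of a vector is at most twice its
    \<open>tv_norm\<close>: the error at \<open>k\<close> is then below
    \<open>\<pi> $ k / 2\<close>.\<close>
  then have "eventually (\<lambda>t. R * exp (- \<rho> * real t) < \<pi> $ k / 4) sequentially"
    using k by (intro order_tendstoD(2)) auto
  \<comment> \<open>\<open>T\<close> becomes a block length by which times are divided, so it has to
    be positive.\<close>
  then have "eventually (\<lambda>t. R * exp (- \<rho> * real t) < \<pi> $ k / 4 \<and> 0 < t) sequentially"
    by (intro eventually_conj eventually_gt_at_top)
  then obtain T where T: "R * exp (- \<rho> * real T) < \<pi> $ k / 4" "0 < T"
    by (auto dest!: eventually_happens)
  have "\<pi> $ k / 2 \<le> transition_op A T \<mu> $ k" if "\<mu> \<in> prob_measures" for \<mu>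
    using ergodic_withD[OF erg assms(1) \<pi> that, of T] T
      abs_component_le_tv_norm[of "transition_op A T \<mu> - \<pi>" k]
    by auto
  then show ?thesis
    using that[of T "\<pi> $ k / 2" k] T k prob_measures_le_1[OF \<pi>, of k] by auto
qed

text \<open>Time is cut into blocks of length \<open>T\<close>. Each block contracts the distance to
  \<open>\<pi>\<close>, which stays fixed under \<open>B\<close>.\<close>

lemma minorization_imp_geometric:
  assumes B: "transition_matrix B" and "\<epsilon> \<le> 1"
    and minor: "\<And>\<mu>. \<mu> \<in> prob_measures \<Longrightarrow> \<epsilon> \<le> transition_op B T \<mu> $ k"
    and \<pi>: "\<pi> \<in> prob_measures" "B *v \<pi> = \<pi>" and \<mu>: "\<mu> \<in> prob_measures"
  shows "tv_norm (transition_op B t \<mu> - \<pi>) \<le> (1 - \<epsilon>) ^ (t div T)"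
proof -
  \<comment> \<open>The \<open>r\<close> leftover steps run first and only keep the distance at most
    \<open>1\<close>; every block added by the induction is then a full one.\<close>
  have "tv_norm (transition_op B (q * T + r) \<mu> - \<pi>) \<le> (1 - \<epsilon>) ^ q" for q r
  proof (induction q)
    case 0
    then show ?case by (simp add: tv_norm_diff_le_1 transition_op_prob_measures B \<mu> \<pi>)
  next
    case (Suc q)
    let ?\<nu> = "transition_op B (q * T + r) \<mu>"
    have "transition_op B (Suc q * T + r) \<mu> - \<pi> = transition_op B T ?\<nu> - transition_op B T \<pi>"
      by (simp add: transition_op_stationary \<pi> add.assoc flip: transition_op_add)
    also have "tv_norm \<dots> \<le> (1 - \<epsilon>) * tv_norm (?\<nu> - \<pi>)"
      by (rule doeblin_contraction)
        (auto intro: linear_transition_op transition_op_prob_measures B minor \<pi> \<mu>)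
    also have "\<dots> \<le> (1 - \<epsilon>) * (1 - \<epsilon>) ^ q"
      using Suc.IH \<open>\<epsilon> \<le> 1\<close> by (intro mult_left_mono) auto
    finally show ?case by simp
  qed
  from this[of "t div T" "t mod T"] show ?thesis by simp
qed

text \<open>Rounding \<open>t / T\<close> down loses less than one block, and the factor
  \<open>1 / x\<close> pays for it.\<close>

lemma power_div_le_exp:
  fixes x :: real
  assumes "0 < x" "x < 1" "0 < T"
  shows "x ^ (t div T) \<le> 1 / x * exp (- (- ln x / real T) * real t)"
proof -
  have "t < (t div T + 1) * T"
    using \<open>0 < T\<close> dividend_less_div_times[of T t] by (simp add: algebra_simps)
  then have "real t < (real (t div T) + 1) * real T"
    by (metis of_nat_1 of_nat_add of_nat_less_iff of_nat_mult)
  then have "real t / real T \<le> real (t div T) + 1"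
    using \<open>0 < T\<close> by (simp add: field_simps)
  then have "ln x * (real (t div T) + 1) \<le> ln x * (real t / real T)"
    using assms by (intro mult_left_mono_neg) auto
  then have "exp (real (t div T) * ln x) \<le> exp (- ln x + ln x * (real t / real T))"
    by (simp add: algebra_simps)
  moreover have "exp (real (t div T) * ln x) = x ^ (t div T)"
    using \<open>0 < x\<close> by (simp add: exp_of_nat_mult)
  moreover have "exp (- ln x + ln x * (real t / real T)) = 1 / x * exp (- (- ln x / real T) * real t)"
    using \<open>0 < x\<close> by (simp add: exp_diff field_simps)
  ultimately show ?thesis by simp
qed

text \<open>For \<open>y \<le> 1\<close> a smaller exponent increases the power; for
  \<open>y > 1\<close> the power is at least \<open>1\<close>, which already bounds
  \<open>f\<close>.\<close>

lemma le_powr_if_le_1: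
  fixes f y \<theta> :: real
  assumes "f \<le> 1" "f \<le> y" "0 < y" "0 \<le> \<theta>" "\<theta> \<le> 1"
  shows "f \<le> y powr \<theta>"
proof (cases "y \<le> 1")
  case True
  then have "y powr 1 \<le> y powr \<theta>" using assms by (intro powr_mono') auto
  then show ?thesis using assms by simp
next
  case False
  then show ?thesis using assms ge_one_powr_ge_zero[of y \<theta>] by simp
qed

lemma ergodic_with_interpolate:
  assumes "transition_matrix B" "\<pi> \<in> prob_measures" "ergodic_with (transition_op B) \<pi> R \<rho>"
    and "0 < R" "0 \<le> \<theta>" "\<theta> \<le> 1" "R powr \<theta> \<le> R'"
  shows "ergodic_with (transition_op B) \<pi> R' (\<theta> * \<rho>)"
proof (rule ergodic_withI)
  fix t and \<mu> :: "real^'a" assume \<mu>: "\<mu> \<in> prob_measures"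
  have "tv_norm (transition_op B t \<mu> - \<pi>) \<le> (R * exp (- \<rho> * real t)) powr \<theta>"
    using assms \<mu>
    by (intro le_powr_if_le_1 ergodic_withD tv_norm_diff_le_1 transition_op_prob_measures) auto
  also have "\<dots> = R powr \<theta> * exp (- (\<theta> * \<rho>) * real t)"
    using \<open>0 < R\<close> by (simp add: powr_mult) (simp add: powr_def algebra_simps)
  also have "\<dots> \<le> R' * exp (- (\<theta> * \<rho>) * real t)"
    using assms by (intro mult_right_mono) auto
  finally show "tv_norm (transition_op B t \<mu> - \<pi>) \<le> R' * exp (- (\<theta> * \<rho>) * real t)" .
qed

theorem theorem3p5:
  fixes A :: "real^'n^'n" and \<gamma> :: real
  assumes "transition_matrix A"
    and "0 < \<gamma>" and "\<gamma> < 1"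
    and "uniformly_ergodic (transition_op A)"
  shows "(\<forall>B. transition_matrix B \<and> controlled_by \<gamma> A B \<longrightarrow> uniformly_ergodic (transition_op B)) \<and>
    (\<exists>R\<^sub>0>0. \<exists>\<rho>\<^sub>0>0.
      (\<forall>B. transition_matrix B \<and> controlled_by \<gamma> A B \<longrightarrow>
         (\<exists>\<pi>\<in>prob_measures. ergodic_with (transition_op B) \<pi> R\<^sub>0 \<rho>\<^sub>0)) \<and>
      (\<forall>R>1. \<exists>\<rho>>0. \<rho> \<le> \<rho>\<^sub>0 \<and>
         (\<forall>B. transition_matrix B \<and> controlled_by \<gamma> A B \<longrightarrow>
            (\<exists>\<pi>\<in>prob_measures. ergodic_with (transition_op B) \<pi> R \<rho>))))"
proof -
  obtain T k \<epsilon>' where "0 < T" and \<epsilon>': "0 < \<epsilon>'" "\<epsilon>' < 1"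
    and minorA: "\<And>\<mu>. \<mu> \<in> prob_measures \<Longrightarrow> \<epsilon>' \<le> transition_op A T \<mu> $ k"
    using uniformly_ergodic_imp_minorization[OF assms(1,4)] by metis
  \<comment> \<open>This and the two constants below are fixed before any \<open>B\<close> is
    chosen, which gives the uniformity over \<open>B\<close>; only the stationary law will vary with
    \<open>B\<close>.\<close>
  define \<epsilon> where "\<epsilon> = \<gamma> ^ T * \<epsilon>'"
  have "\<gamma> ^ T * \<epsilon>' \<le> 1 * \<epsilon>'" using assms \<epsilon>' by (intro mult_right_mono power_le_one) auto
  then have "\<epsilon> < 1" using \<epsilon>' unfolding \<epsilon>_def by linarith
  moreover have "0 < \<epsilon>" using assms \<epsilon>' by (simp add: \<epsilon>_def)
  ultimately have \<epsilon>: "0 < \<epsilon>" "\<epsilon> < 1" by simp_all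
  \<comment> \<open>These are the constants of \<open>power_div_le_exp\<close> for
    \<open>x = 1 - \<epsilon>\<close>.\<close>
  define R\<^sub>0 where "R\<^sub>0 = 1 / (1 - \<epsilon>)"
  define \<rho>\<^sub>0 where "\<rho>\<^sub>0 = - ln (1 - \<epsilon>) / real T"
  have R0: "1 < R\<^sub>0" using \<epsilon> by (simp add: R\<^sub>0_def)
  have \<rho>0: "0 < \<rho>\<^sub>0" using \<epsilon> \<open>0 < T\<close> by (simp add: \<rho>\<^sub>0_def divide_neg_pos)
  have main: "\<exists>\<pi>\<in>prob_measures. ergodic_with (transition_op B) \<pi> R\<^sub>0 \<rho>\<^sub>0"
    if B: "transition_matrix B" "controlled_by \<gamma> A B" for B
  proof -
    obtain \<pi> where \<pi>: "\<pi> \<in> prob_measures" "B *v \<pi> = \<pi>"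
      using stationary_measure_exists[OF B(1)] .
    have minorB: "\<epsilon> \<le> transition_op B T \<mu> $ k" if \<mu>: "\<mu> \<in> prob_measures" for \<mu>
    proof -
      have "\<epsilon> \<le> \<gamma> ^ T * transition_op A T \<mu> $ k"
        unfolding \<epsilon>_def using assms minorA[OF \<mu>] by (intro mult_left_mono) auto
      then show ?thesis
        using transition_op_controlled[OF assms(1) B(2) _ \<mu>, of T k] assms(2) by simp
    qed
    have "ergodic_with (transition_op B) \<pi> R\<^sub>0 \<rho>\<^sub>0"
    proof (rule ergodic_withI)
      fix t and \<mu> :: "real^'n" assume \<mu>: "\<mu> \<in> prob_measures"
      have "tv_norm (transition_op B t \<mu> - \<pi>) \<le> (1 - \<epsilon>) ^ (t div T)"
        using \<epsilon> by (intro minorization_imp_geometric[OF B(1) _ minorB \<pi> \<mu>]) auto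
      also have "\<dots> \<le> R\<^sub>0 * exp (- \<rho>\<^sub>0 * real t)"
        unfolding R\<^sub>0_def \<rho>\<^sub>0_def using \<epsilon> \<open>0 < T\<close> by (intro power_div_le_exp) auto
      finally show "tv_norm (transition_op B t \<mu> - \<pi>) \<le> R\<^sub>0 * exp (- \<rho>\<^sub>0 * real t)" .
    qed
    then show ?thesis using \<pi> by blast
  qed
  have close: "\<exists>\<rho>>0. \<rho> \<le> \<rho>\<^sub>0 \<and>
      (\<forall>B. transition_matrix B \<and> controlled_by \<gamma> A B \<longrightarrow>
        (\<exists>\<pi>\<in>prob_measures. ergodic_with (transition_op B) \<pi> R \<rho>))" if "1 < R" for R
  proof -
    \<comment> \<open>\<open>ln R / ln R\<^sub>0\<close> solves
      \<open>R\<^sub>0 powr \<theta> = R\<close>. The cap at \<open>1\<close> covers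
      \<open>R > R\<^sub>0\<close> and keeps the new rate at most
      \<open>\<rho>\<^sub>0\<close>.\<close>
    define \<theta> where "\<theta> = min 1 (ln R / ln R\<^sub>0)"
    have \<theta>: "0 < \<theta>" "\<theta> \<le> 1" using that R0 by (auto simp: \<theta>_def)
    have "\<theta> * ln R\<^sub>0 \<le> ln R / ln R\<^sub>0 * ln R\<^sub>0"
      using R0 by (intro mult_right_mono) (auto simp: \<theta>_def)
    then have "exp (\<theta> * ln R\<^sub>0) \<le> exp (ln R)" using R0 by simp
    then have "R\<^sub>0 powr \<theta> \<le> R" using R0 that by (simp add: powr_def)
    then have "\<exists>\<pi>\<in>prob_measures. ergodic_with (transition_op B) \<pi> R (\<theta> * \<rho>\<^sub>0)"
      if "transition_matrix B" "controlled_by \<gamma> A B" for B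
      using main[OF that] ergodic_with_interpolate[OF that(1), of _ R\<^sub>0 \<rho>\<^sub>0 \<theta> R] R0 \<theta> by auto
    moreover have "\<theta> * \<rho>\<^sub>0 \<le> \<rho>\<^sub>0" using \<theta> \<rho>0 by simp
    ultimately show ?thesis using \<theta> \<rho>0 by (intro exI[of _ "\<theta> * \<rho>\<^sub>0"]) auto
  qed
  have "0 < R\<^sub>0" using R0 by simp
  then show ?thesis
    using main close \<rho>0 unfolding uniformly_ergodic_def by blast
qed

end
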